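(* Let $G$ and $G'$ be finite abelian groups and let $q:G\to\mathbb Q/\mathbb Z$ and $q':G'\to\mathbb Q/\mathbb Z$ be nondegenerate quadratic functions. Then $q$ and $q'$ are isomorphic if and only if there is a group isomorphism $\psi:G\to G'$ such that $\psi^*b_{q'}=b_q$ and $\psi^*d_{q'}=d_q$, and $\gamma(q')=\gamma(q)$.
   Context: A quadratic function on a torsion abelian group $G$ is a map $q:G\to\mathbb Q/\mathbb Z$ such that $b_q(x,y)=q(x+y)-q(x)-q(y)$ is $\mathbb Z$-bilinear on $G\times G$ (no homogeneity is required). It is nondegenerate if the adjoint $G\to\mathrm{Hom}(G,\mathbb Q/\mathbb Z)$, $x\mapsto b_q(x,-)$, is injective. Its homogeneity defect is the homomorphism $d_q\in\mathrm{Hom}(G,\mathbb Q/\mathbb Z)$, $d_q(x)=q(x)-q(-x)$. For $G$ finite, the Gauss sum is $\gamma(q)=|G|^{-1/2}\sum_{x\in G}\exp(2\pi i\,q(x))\in\mathbb C$. For a group isomorphism $\psi:G\to G'$: $\psi^*b_{q'}(x,y)=b_{q'}(\psi(x),\psi(y))$, $\psi^*d_{q'}=d_{q'}\circ\psi$, $\psi^*q'=q'\circ\psi$. Two quadratic functions $q$ on $G$ and $q'$ on $G'$ are isomorphic if there is a group isomorphism $\theta$ between $G$ and $G'$ carrying one to the other (e.g. $\theta:G\to G'$ with $q'\circ\theta=q$). *)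

theory Defs
  imports Complex_Main "HOL-Algebra.Group"
begin

section \<open>The group of rational numbers modulo the integers\<close>

quotient_type qmodz = rat / "\<lambda>r s. r - s \<in> \<int>"
proof (rule equivpI)
  show "reflp (\<lambda>r s :: rat. r - s \<in> \<int>)"
    by (simp add: reflp_def)
  show "symp (\<lambda>r s :: rat. r - s \<in> \<int>)"
  proof (rule sympI)
    fix r s :: rat
    assume "r - s \<in> \<int>"
    then have "- (r - s) \<in> \<int>" by (rule Ints_minus)
    then show "s - r \<in> \<int>" by simp
  qed
  show "transp (\<lambda>r s :: rat. r - s \<in> \<int>)"
  proof (rule transpI)
    fix r s t :: rat
    assume "r - s \<in> \<int>" "s - t \<in> \<int>"
    then have "(r - s) + (s - t) \<in> \<int>" by (rule Ints_add)
    then show "r - t \<in> \<int>" by simp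
  qed
qed

instantiation qmodz :: ab_group_add
begin

lift_definition zero_qmodz :: qmodz is 0 .

lift_definition plus_qmodz :: "qmodz \<Rightarrow> qmodz \<Rightarrow> qmodz" is "(+)"
proof -
  fix a b c d :: rat
  assume "a - b \<in> \<int>" "c - d \<in> \<int>"
  then have "(a - b) + (c - d) \<in> \<int>" by (rule Ints_add)
  then show "(a + c) - (b + d) \<in> \<int>" by (simp add: algebra_simps)
qed

lift_definition uminus_qmodz :: "qmodz \<Rightarrow> qmodz" is uminus
proof -
  fix a b :: rat
  assume "a - b \<in> \<int>"
  then have "- (a - b) \<in> \<int>" by (rule Ints_minus)
  then show "- a - - b \<in> \<int>" by simp
qed

lift_definition minus_qmodz :: "qmodz \<Rightarrow> qmodz \<Rightarrow> qmodz" is "(-)"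
proof -
  fix a b c d :: rat
  assume "a - b \<in> \<int>" "c - d \<in> \<int>"
  then have "(a - b) - (c - d) \<in> \<int>" by (rule Ints_diff)
  then show "(a - c) - (b - d) \<in> \<int>" by (simp add: algebra_simps)
qed

instance
  by standard (transfer; simp add: algebra_simps)+

end

text \<open>The additive group of \<open>qmodz\<close> as a target for \<open>hom\<close>.\<close>

definition QZ :: "qmodz monoid" where
  "QZ = \<lparr>carrier = UNIV, monoid.mult = (+), one = 0\<rparr>"

text \<open>The character \<open>r + \<int> \<mapsto> exp (2 \<pi> \<i> r)\<close>.\<close>

lift_definition exp_qmodz :: "qmodz \<Rightarrow> complex"
  is "\<lambda>r. exp (2 * of_real pi * \<i> * of_rat r)"
proof -
  fix r s :: rat
  assume "r - s \<in> \<int>"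
  then obtain n where "r - s = of_int n" by (auto elim: Ints_cases)
  then have r: "r = s + of_int n" by (simp add: algebra_simps)
  have "exp (2 * of_real pi * \<i> * of_rat r :: complex)
      = exp (2 * of_real pi * \<i> * of_rat s) * exp (2 * of_real pi * \<i> * of_int n)"
    by (simp only: r of_rat_add of_rat_of_int_eq distrib_left exp_add)
  also have "exp (2 * of_real pi * \<i> * of_int n :: complex) = 1"
  proof -
    have "exp (2 * of_real pi * \<i> * of_int n :: complex) = cis (2 * pi * of_int n)"
      unfolding cis_conv_exp by (rule arg_cong[where f = exp]) (simp add: mult_ac)
    then show ?thesis by (simp add: cis_multiple_2pi)
  qed
  finally show "exp (2 * of_real pi * \<i> * of_rat r :: complex)
      = exp (2 * of_real pi * \<i> * of_rat s)"
    by simp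
qed


section \<open>Quadratic functions\<close>

text \<open>
  The abelian group is written multiplicatively, following \<^theory>\<open>HOL-Algebra.Group\<close>.
  A function on the group is represented by a total function on the underlying type, of
  which only the values on the carrier are meaningful.
\<close>

definition assoc_bilin ::
    "('a, 'm) monoid_scheme \<Rightarrow> ('a \<Rightarrow> qmodz) \<Rightarrow> 'a \<Rightarrow> 'a \<Rightarrow> qmodz" where
  "assoc_bilin G q x y = q (x \<otimes>\<^bsub>G\<^esub> y) - q x - q y"

definition quadratic_function :: "('a, 'm) monoid_scheme \<Rightarrow> ('a \<Rightarrow> qmodz) \<Rightarrow> bool" where
  "quadratic_function G q \<longleftrightarrow>
     (\<forall>x\<in>carrier G. (\<lambda>y. assoc_bilin G q x y) \<in> hom G QZ) \<and>
     (\<forall>y\<in>carrier G. (\<lambda>x. assoc_bilin G q x y) \<in> hom G QZ)"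

text \<open>
  The restriction makes equality of two values of the adjoint mean equality as functions on the carrier.
\<close>

definition adjoint_map ::
    "('a, 'm) monoid_scheme \<Rightarrow> ('a \<Rightarrow> qmodz) \<Rightarrow> 'a \<Rightarrow> 'a \<Rightarrow> qmodz" where
  "adjoint_map G q x = restrict (assoc_bilin G q x) (carrier G)"

definition nondegenerate :: "('a, 'm) monoid_scheme \<Rightarrow> ('a \<Rightarrow> qmodz) \<Rightarrow> bool" where
  "nondegenerate G q \<longleftrightarrow> inj_on (adjoint_map G q) (carrier G)"

definition homogeneity_defect ::
    "('a, 'm) monoid_scheme \<Rightarrow> ('a \<Rightarrow> qmodz) \<Rightarrow> 'a \<Rightarrow> qmodz" where
  "homogeneity_defect G q x = q x - q (inv\<^bsub>G\<^esub> x)"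

definition gauss_sum :: "('a, 'm) monoid_scheme \<Rightarrow> ('a \<Rightarrow> qmodz) \<Rightarrow> complex" where
  "gauss_sum G q =
     (\<Sum>x\<in>carrier G. exp_qmodz (q x)) / of_real (sqrt (real (card (carrier G))))"

definition quadratic_isomorphic ::
    "('a, 'm) monoid_scheme \<Rightarrow> ('a \<Rightarrow> qmodz) \<Rightarrow>
     ('b, 'n) monoid_scheme \<Rightarrow> ('b \<Rightarrow> qmodz) \<Rightarrow> bool" where
  "quadratic_isomorphic G q G' q' \<longleftrightarrow>
     (\<exists>\<theta>\<in>iso G G'. \<forall>x\<in>carrier G. q' (\<theta> x) = q x)"

end

theory Submission
  imports Defs
begin

text \<open>
  Write the groups additively. Only the converse direction has content. Transporting \<open>q'\<close> along \<open>\<psi>\<close>, one may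
  assume that both functions live on \<open>G\<close> and have the same bilinear form \<open>b\<close> and the same
  homogeneity defect. Equality of the bilinear forms makes \<open>q' - q\<close> a homomorphism, and equality of the
  defects makes it 2-torsion. As \<open>b\<close> is perfect (\<open>hom_represented\<close>),
  \<open>q' = q + b(-, c)\<close> for some \<open>c\<close>, and nondegeneracy gives \<open>2 c = 0\<close>.

  Since \<open>q' x = q (x + c) - q c\<close>, the two Gauss sums differ by the phase
  \<open>exp (- 2 \<pi> \<i> q(c))\<close>. The Gauss sum of \<open>q\<close> does not vanish (\<open>gauss_numerator_nonzero\<close>),
  so equal Gauss sums force \<open>q c = 0\<close>, whence also
  \<open>b(c, c) = q (2 c) - 2 q c = 0\<close>. It remains to write down an automorphism
  carrying \<open>q\<close> to \<open>q'\<close>: the transvection along \<open>c\<close>, which fixes the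
  \<open>x\<close> orthogonal to \<open>c\<close> and sends every other \<open>x\<close> to \<open>x + c\<close>. It is an
  involution because \<open>c\<close> is orthogonal to itself, and for \<open>x\<close> with \<open>b(x, c) = 1/2\<close>
  one finds \<open>q' (x + c) = q x + 2 b(x, c) = q x\<close> (\<open>transvection_isometry\<close>).
\<close>

section \<open>Characters with values in the rationals modulo the integers\<close>

lemma exp_qmodz_0: "exp_qmodz 0 = 1"
  by transfer simp

lemma exp_qmodz_add: "exp_qmodz (a + b) = exp_qmodz a * exp_qmodz b"
  by transfer (simp add: of_rat_add distrib_left exp_add)

lemma exp_qmodz_eq_1_iff: "exp_qmodz a = 1 \<longleftrightarrow> a = 0"
proof transfer
  fix r :: rat
  have "exp (2 * of_real pi * \<i> * of_rat r :: complex) = 1 \<longleftrightarrow> r \<in> \<int>"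
  proof
    assume "exp (2 * of_real pi * \<i> * of_rat r :: complex) = 1"
    moreover have "2 * of_real pi * \<i> * of_rat r = \<i> * complex_of_real (2 * pi * of_rat r)"
      by (cases r) (simp add: of_rat_rat)
    ultimately have "cis (2 * pi * of_rat r) = 1"
      by (simp only: cis_conv_exp)
    then have "cos (2 * pi * of_rat r) = 1"
      by (metis cis.sel(1) one_complex.sel(1))
    then obtain n :: int where "2 * pi * of_rat r = of_int n * 2 * pi"
      by (auto simp: cos_one_2pi_int)
    then have "(of_rat r :: real) = of_int n"
      by simp
    then have "r = of_int n"
      by (metis of_rat_eq_iff of_rat_of_int_eq)
    then show "r \<in> \<int>"
      by simp
  next
    assume "r \<in> \<int>"
    then have "abs_qmodz r = 0"
      by (simp add: zero_qmodz_def qmodz.abs_eq_iff)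
    then show "exp (2 * of_real pi * \<i> * of_rat r :: complex) = 1"
      by (metis exp_qmodz.abs_eq exp_qmodz_0)
  qed
  then show "exp (2 * of_real pi * \<i> * of_rat r :: complex) = 1 \<longleftrightarrow> r - 0 \<in> \<int>"
    by simp
qed

text \<open>A rational class killed by doubling is \<open>0\<close> or \<open>1/2\<close>, so two nonzero ones cancel.\<close>

lemma qmodz_two_torsion_add:
  fixes a b :: qmodz
  assumes "a + a = 0" "b + b = 0" "a \<noteq> 0" "b \<noteq> 0"
  shows "a + b = 0"
  using assms
proof transfer
  fix a b :: rat
  assume "a + a - 0 \<in> \<int>" "b + b - 0 \<in> \<int>" and na: "a - 0 \<notin> \<int>" and nb: "b - 0 \<notin> \<int>"
  then obtain m n where mn: "a + a = of_int m" "b + b = of_int n"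
    by (auto elim!: Ints_cases)
  have "odd m"
  proof
    assume "even m"
    then obtain k where "m = 2 * k" by (elim evenE)
    with mn have "a = of_int k" by simp
    with na show False by simp
  qed
  moreover have "odd n"
  proof
    assume "even n"
    then obtain k where "n = 2 * k" by (elim evenE)
    with mn have "b = of_int k" by simp
    with nb show False by simp
  qed
  ultimately obtain k where "m + n = 2 * k"
    by (meson evenE odd_even_add)
  have "2 * (a + b) = (a + a) + (b + b)"
    by simp
  also have "\<dots> = of_int (2 * k)"
    unfolding mn \<open>m + n = 2 * k\<close>[symmetric] by simp
  finally have "2 * (a + b) = of_int (2 * k)" .
  then have "a + b = of_int k" by simp
  then show "a + b - 0 \<in> \<int>" by simp
qed

lemma hom_QZ_iff:
  "f \<in> hom G QZ \<longleftrightarrow>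
    (\<forall>x\<in>carrier G. \<forall>y\<in>carrier G. f (x \<otimes>\<^bsub>G\<^esub> y) = f x + f y)"
  by (auto simp: hom_def QZ_def)

lemma (in group) hom_QZ_one:
  assumes "f \<in> hom G QZ"
  shows "f \<one> = 0"
  using assms by (metis add_cancel_right_right hom_QZ_iff l_one one_closed)

lemma (in group) hom_QZ_inv:
  assumes "f \<in> hom G QZ" "x \<in> carrier G"
  shows "f (inv x) = - f x"
  using assms hom_QZ_one[OF assms(1)]
  by (metis add.inverse_unique hom_QZ_iff inv_closed r_inv)

lemma (in group) sum_translate:
  assumes "a \<in> carrier G"
  shows "(\<Sum>x\<in>carrier G. f (x \<otimes> a)) = (\<Sum>x\<in>carrier G. f x)"
proof (rule sum.reindex_bij_betw)
  show "bij_betw (\<lambda>x. x \<otimes> a) (carrier G) (carrier G)"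
    by (rule bij_betw_byWitness[where f' = "\<lambda>x. x \<otimes> inv a"])
      (use assms in \<open>auto simp: m_assoc\<close>)
qed

text \<open>Translating by an element on which the character is not \<open>1\<close> multiplies the sum by
  a factor other than \<open>1\<close> without changing it.\<close>

lemma (in group) character_sum_eq_0:
  assumes f: "f \<in> hom G QZ" and a: "a \<in> carrier G" "f a \<noteq> 0"
  shows "(\<Sum>x\<in>carrier G. exp_qmodz (f x)) = 0"
proof -
  let ?S = "\<Sum>x\<in>carrier G. exp_qmodz (f x)"
  have "?S = (\<Sum>x\<in>carrier G. exp_qmodz (f (x \<otimes> a)))"
    by (rule sum_translate[OF a(1), symmetric])
  also have "\<dots> = ?S * exp_qmodz (f a)"
    unfolding sum_distrib_right
    by (rule sum.cong) (use f a in \<open>auto simp: hom_QZ_iff exp_qmodz_add\<close>)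
  finally show ?thesis
    using a(2) by (auto simp: exp_qmodz_eq_1_iff)
qed


section \<open>Nondegenerate quadratic functions on a finite abelian group\<close>

locale finite_nondegenerate_quadratic = comm_group G
  for G :: "('a, 'm) monoid_scheme" (structure) +
  fixes q :: "'a \<Rightarrow> qmodz"
  assumes finite_carrier: "finite (carrier G)"
    and quadratic: "quadratic_function G q"
    and nondeg: "nondegenerate G q"
begin

abbreviation b :: "'a \<Rightarrow> 'a \<Rightarrow> qmodz" where
  "b \<equiv> assoc_bilin G q"

lemma b_hom_right: "x \<in> carrier G \<Longrightarrow> (\<lambda>y. b x y) \<in> hom G QZ"
  and b_hom_left: "y \<in> carrier G \<Longrightarrow> (\<lambda>x. b x y) \<in> hom G QZ"
  using quadratic by (auto simp: quadratic_function_def)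

lemma b_mult_left:
  "\<lbrakk>x \<in> carrier G; y \<in> carrier G; z \<in> carrier G\<rbrakk> \<Longrightarrow> b (x \<otimes> y) z = b x z + b y z"
  using b_hom_left by (auto simp: hom_QZ_iff)

lemma b_mult_right:
  "\<lbrakk>x \<in> carrier G; y \<in> carrier G; z \<in> carrier G\<rbrakk> \<Longrightarrow> b x (y \<otimes> z) = b x y + b x z"
  using b_hom_right by (auto simp: hom_QZ_iff)

lemma b_sym: "\<lbrakk>x \<in> carrier G; y \<in> carrier G\<rbrakk> \<Longrightarrow> b x y = b y x"
  by (simp add: assoc_bilin_def m_comm)

lemma b_one_left: "y \<in> carrier G \<Longrightarrow> b \<one> y = 0"
  using hom_QZ_one[OF b_hom_left] by simp

lemma q_mult: "q (x \<otimes> y) = q x + q y + b x y"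
  by (simp add: assoc_bilin_def)

lemma q_one: "q \<one> = 0"
  using b_one_left[OF one_closed] by (simp add: assoc_bilin_def)

lemma b_eq_0_imp_one:
  assumes "x \<in> carrier G" "\<And>y. y \<in> carrier G \<Longrightarrow> b x y = 0"
  shows "x = \<one>"
proof -
  have "adjoint_map G q x = adjoint_map G q \<one>"
    unfolding adjoint_map_def by (rule restrict_ext) (simp add: assms b_one_left)
  with nondeg assms(1) show ?thesis
    by (auto simp: nondegenerate_def dest: inj_onD)
qed

lemma b_character_sum:
  assumes x: "x \<in> carrier G"
  shows "(\<Sum>y\<in>carrier G. exp_qmodz (b x y)) = (if x = \<one> then of_nat (card (carrier G)) else 0)"
proof (cases "x = \<one>")
  case True
  then show ?thesis by (simp add: b_one_left exp_qmodz_0)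
next
  case False
  then obtain y where "y \<in> carrier G" "b x y \<noteq> 0"
    using b_eq_0_imp_one[OF x] by blast
  with False show ?thesis
    using character_sum_eq_0[OF b_hom_right[OF x]] by simp
qed

text \<open>
  The injective adjoint of \<open>b\<close> is onto. Otherwise some character \<open>f\<close> differs from every
  \<open>b(-, y)\<close>, so that the sums of \<open>f + b(-, y)\<close> over the group all vanish. But summing these over
  \<open>y\<close> first leaves only the term at the neutral element, which is the order of the group.
\<close>

lemma hom_represented:
  assumes f: "f \<in> hom G QZ"
  obtains c where "c \<in> carrier G" "\<And>x. x \<in> carrier G \<Longrightarrow> f x = b x c"
proof -
  let ?A = "carrier G"
  have "\<exists>y\<in>?A. \<forall>x\<in>?A. f x + b x y = 0"
  proof (rule ccontr)
    assume contra: "\<not> ?thesis"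
    have vanish: "(\<Sum>x\<in>?A. exp_qmodz (f x + b x y)) = 0" if y: "y \<in> ?A" for y
    proof -
      obtain a where a: "a \<in> ?A" "f a + b a y \<noteq> 0"
        using contra y by blast
      have "(\<lambda>x. f x + b x y) \<in> hom G QZ"
        using f y by (auto simp: hom_QZ_iff b_mult_left)
      from character_sum_eq_0[OF this a] show ?thesis .
    qed
    have "0 = (\<Sum>y\<in>?A. \<Sum>x\<in>?A. exp_qmodz (f x + b x y))"
      by (simp add: vanish)
    also have "\<dots> = (\<Sum>x\<in>?A. \<Sum>y\<in>?A. exp_qmodz (f x + b x y))"
      by (rule sum.swap)
    also have "\<dots> = (\<Sum>x\<in>?A. if x = \<one> then of_nat (card ?A) else 0)"
      by (rule sum.cong)
        (simp_all add: exp_qmodz_add b_character_sum hom_QZ_one[OF f] exp_qmodz_0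
          flip: sum_distrib_left)
    also have "\<dots> = of_nat (card ?A)"
      using finite_carrier by simp
    finally show False
      using finite_carrier one_closed by auto
  qed
  then obtain y where y: "y \<in> ?A" "\<And>x. x \<in> ?A \<Longrightarrow> f x + b x y = 0"
    by blast
  show thesis
  proof
    show "inv y \<in> ?A" using y(1) by simp
    show "f x = b x (inv y)" if "x \<in> ?A" for x
      unfolding hom_QZ_inv[OF b_hom_right[OF that] y(1)] eq_neg_iff_add_eq_0
      by (rule y(2)[OF that])
  qed
qed

text \<open>
  The classical computation of the absolute value: multiplied by its conjugate, the sum becomes a
  double sum over \<open>q (x + y) - q y = q x + b(x, y)\<close>, in which only \<open>x = 0\<close> survives.
\<close>

lemma gauss_numerator_nonzero: "(\<Sum>x\<in>carrier G. exp_qmodz (q x)) \<noteq> 0"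
proof
  let ?A = "carrier G"
  assume zero: "(\<Sum>x\<in>?A. exp_qmodz (q x)) = 0"
  have "0 = (\<Sum>y\<in>?A. exp_qmodz (- q y) * (\<Sum>x\<in>?A. exp_qmodz (q (x \<otimes> y))))"
    by (simp add: sum_translate[where f = "\<lambda>x. exp_qmodz (q x)"] zero)
  also have "\<dots> = (\<Sum>y\<in>?A. \<Sum>x\<in>?A. exp_qmodz (q x) * exp_qmodz (b x y))"
    by (simp add: sum_distrib_left q_mult flip: exp_qmodz_add)
  also have "\<dots> = (\<Sum>x\<in>?A. \<Sum>y\<in>?A. exp_qmodz (q x) * exp_qmodz (b x y))"
    by (rule sum.swap)
  also have "\<dots> = (\<Sum>x\<in>?A. if x = \<one> then of_nat (card ?A) else 0)"
    by (rule sum.cong) (simp_all add: b_character_sum q_one exp_qmodz_0 flip: sum_distrib_left)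
  also have "\<dots> = of_nat (card ?A)"
    using finite_carrier by simp
  finally show False
    using finite_carrier one_closed by auto
qed

text \<open>
  For \<open>x\<close> not orthogonal to \<open>c\<close>, the value \<open>b(x, c)\<close> enters \<open>q + b(-, c)\<close>
  at \<open>x + c\<close> twice, once through \<open>q\<close> and once through the added character; being
  2-torsion, it cancels.
\<close>

lemma transvection_isometry:
  assumes c: "c \<in> carrier G" "c \<otimes> c = \<one>" "q c = 0"
  obtains \<theta> where "\<theta> \<in> iso G G" "\<And>x. x \<in> carrier G \<Longrightarrow> q (\<theta> x) + b (\<theta> x) c = q x"
proof
  let ?t = "\<lambda>x. if b x c = 0 then x else x \<otimes> c"
  have bcc: "b c c = 0"
    using c by (simp add: assoc_bilin_def q_one)
  have two: "b x c + b x c = 0" if "x \<in> carrier G" for x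
    using that c b_mult_right[of x c c] hom_QZ_one[OF b_hom_right] by simp
  have cc: "x \<otimes> c \<otimes> c = x" if "x \<in> carrier G" for x
    using that c by (simp add: m_assoc)
  have closed: "?t x \<in> carrier G" if "x \<in> carrier G" for x
    using that c by simp
  have b_t: "b (?t x) c = b x c" if "x \<in> carrier G" for x
    using that c bcc by (simp add: b_mult_left)
  have involution: "?t (?t x) = x" if "x \<in> carrier G" for x
    using that c cc bcc by (simp add: b_mult_left)
  have mult: "?t (x \<otimes> y) = ?t x \<otimes> ?t y" if "x \<in> carrier G" "y \<in> carrier G" for x y
  proof (cases "b x c = 0 \<or> b y c = 0")
    case True
    then show ?thesis using that c by (auto simp: b_mult_left m_ac)
  next
    case False
    then have "b (x \<otimes> y) c = 0"
      using that c(1) qmodz_two_torsion_add[OF two[OF that(1)] two[OF that(2)]]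
      by (simp add: b_mult_left)
    moreover have "(x \<otimes> c) \<otimes> (y \<otimes> c) = x \<otimes> y \<otimes> (c \<otimes> c)"
      using that c(1) by (simp add: m_ac)
    ultimately show ?thesis using False that c(2) by simp
  qed
  have "bij_betw ?t (carrier G) (carrier G)"
    by (rule bij_betw_byWitness[where f' = ?t]) (use involution closed in blast)+
  moreover have "?t \<in> hom G G"
    by (rule homI) (use closed mult in \<open>blast+\<close>)
  ultimately show "?t \<in> iso G G"
    by (simp add: iso_def)
  show "q (?t x) + b (?t x) c = q x" if "x \<in> carrier G" for x
    unfolding b_t[OF that] using two[OF that] c(3) by (simp add: q_mult add.assoc)
qed

lemma isometry_of_equal_invariants:
  assumes bil: "\<And>x y. \<lbrakk>x \<in> carrier G; y \<in> carrier G\<rbrakk> \<Longrightarrow> assoc_bilin G p x y = b x y"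
    and defect: "\<And>x. x \<in> carrier G \<Longrightarrow> homogeneity_defect G p x = homogeneity_defect G q x"
    and gauss: "(\<Sum>x\<in>carrier G. exp_qmodz (p x)) = (\<Sum>x\<in>carrier G. exp_qmodz (q x))"
  obtains \<theta> where "\<theta> \<in> iso G G" "\<And>x. x \<in> carrier G \<Longrightarrow> p (\<theta> x) = q x"
proof -
  let ?f = "\<lambda>x. p x - q x"
  have f: "?f \<in> hom G QZ"
    unfolding hom_QZ_iff
  proof (intro ballI)
    fix x y assume "x \<in> carrier G" "y \<in> carrier G"
    from bil[OF this] show "?f (x \<otimes> y) = ?f x + ?f y"
      by (simp add: assoc_bilin_def algebra_simps)
  qed
  then obtain c where c: "c \<in> carrier G" "\<And>x. x \<in> carrier G \<Longrightarrow> ?f x = b x c"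
    by (rule hom_represented) blast
  then have p: "p x = q x + b x c" if "x \<in> carrier G" for x
    using that by (metis add.commute diff_add_cancel)
  \<comment> \<open>Equal defects say that the character \<open>p - q\<close> is even; being odd as well, it is 2-torsion.\<close>
  have two: "b x c + b x c = 0" if x: "x \<in> carrier G" for x
  proof -
    have "?f x = ?f (inv x)"
      using defect[OF x] by (simp add: homogeneity_defect_def algebra_simps)
    also have "\<dots> = - ?f x"
      by (rule hom_QZ_inv[OF f x])
    finally show ?thesis
      using c(2)[OF x] by (metis add.right_inverse)
  qed
  have cc: "c \<otimes> c = \<one>"
  proof (rule b_eq_0_imp_one)
    show "b (c \<otimes> c) y = 0" if "y \<in> carrier G" for y
      using that c(1) two b_sym[of c y] by (simp add: b_mult_left)
  qed (use c in simp)
  have "(\<Sum>x\<in>carrier G. exp_qmodz (q x)) = (\<Sum>x\<in>carrier G. exp_qmodz (q (x \<otimes> c)))"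
    by (rule sum_translate[OF c(1), symmetric])
  also have "\<dots> = (\<Sum>x\<in>carrier G. exp_qmodz (p x) * exp_qmodz (q c))"
    by (rule sum.cong) (simp_all add: p q_mult add_ac flip: exp_qmodz_add)
  also have "\<dots> = (\<Sum>x\<in>carrier G. exp_qmodz (q x)) * exp_qmodz (q c)"
    by (simp add: gauss flip: sum_distrib_right)
  finally have "q c = 0"
    using gauss_numerator_nonzero by (simp add: exp_qmodz_eq_1_iff)
  from transvection_isometry[OF c(1) cc this]
  obtain \<theta> where \<theta>: "\<theta> \<in> iso G G" "\<And>x. x \<in> carrier G \<Longrightarrow> q (\<theta> x) + b (\<theta> x) c = q x"
    by blast
  show thesis
  proof (rule that[OF \<theta>(1)])
    fix x assume x: "x \<in> carrier G"
    then have "\<theta> x \<in> carrier G"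
      using \<theta>(1) by (auto simp: iso_def hom_def)
    with x show "p (\<theta> x) = q x"
      by (simp add: p \<theta>(2))
  qed
qed

end


section \<open>Classification by bilinear form, defect and Gauss sum\<close>

lemma gauss_sum_iso:
  assumes "\<psi> \<in> iso G G'"
  shows "gauss_sum G' q = gauss_sum G (\<lambda>x. q (\<psi> x))"
proof -
  have bij: "bij_betw \<psi> (carrier G) (carrier G')"
    using assms by (simp add: iso_def)
  show ?thesis
    by (simp add: gauss_sum_def bij_betw_same_card[OF bij]
        sum.reindex_bij_betw[OF bij, of "\<lambda>y. exp_qmodz (q y)"])
qed

lemma assoc_bilin_hom:
  assumes "\<psi> \<in> hom G G'" "x \<in> carrier G" "y \<in> carrier G"
  shows "assoc_bilin G' q (\<psi> x) (\<psi> y) = assoc_bilin G (\<lambda>x. q (\<psi> x)) x y"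
  using assms by (simp add: assoc_bilin_def hom_mult)

lemma homogeneity_defect_hom:
  assumes "group G" "group G'" "\<psi> \<in> hom G G'" "x \<in> carrier G"
  shows "homogeneity_defect G' q (\<psi> x) = homogeneity_defect G (\<lambda>x. q (\<psi> x)) x"
proof -
  interpret group_hom G G' \<psi>
    using assms by (simp add: group_hom_def group_hom_axioms_def)
  show ?thesis
    using assms(4) by (simp add: homogeneity_defect_def)
qed

theorem theorem4p1:
  fixes G :: "('a, 'm) monoid_scheme" and G' :: "('b, 'n) monoid_scheme"
    and q :: "'a \<Rightarrow> qmodz" and q' :: "'b \<Rightarrow> qmodz"
  assumes "comm_group G" and "finite (carrier G)"
    and "comm_group G'" and "finite (carrier G')"
    and "quadratic_function G q" and "nondegenerate G q"
    and "quadratic_function G' q'" and "nondegenerate G' q'"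
  shows "quadratic_isomorphic G q G' q' \<longleftrightarrow>
    (\<exists>\<psi>\<in>Group.iso G G'.
        (\<forall>x\<in>carrier G. \<forall>y\<in>carrier G.
           assoc_bilin G' q' (\<psi> x) (\<psi> y) = assoc_bilin G q x y) \<and>
        (\<forall>x\<in>carrier G. homogeneity_defect G' q' (\<psi> x) = homogeneity_defect G q x)) \<and>
    gauss_sum G' q' = gauss_sum G q"
    (is "?L \<longleftrightarrow> (\<exists>\<psi>\<in>_. ?B \<psi> \<and> ?D \<psi>) \<and> ?\<gamma>")
proof -
  interpret G: comm_group G by fact
  interpret G': comm_group G' by fact
  interpret Q: finite_nondegenerate_quadratic G q
    using assms by (simp add: finite_nondegenerate_quadratic_def
        finite_nondegenerate_quadratic_axioms_def)
  show ?thesis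
  proof
    assume ?L
    then obtain \<theta> where \<theta>: "\<theta> \<in> iso G G'" "\<And>x. x \<in> carrier G \<Longrightarrow> q' (\<theta> x) = q x"
      by (auto simp: quadratic_isomorphic_def)
    then have hom: "\<theta> \<in> hom G G'" by (simp add: iso_def)
    have "?B \<theta>"
      by (simp add: assoc_bilin_hom[OF hom]) (simp add: assoc_bilin_def \<theta>(2))
    moreover have "?D \<theta>"
      by (simp add: homogeneity_defect_hom[OF G.group_axioms G'.group_axioms hom])
        (simp add: homogeneity_defect_def \<theta>(2))
    moreover have ?\<gamma>
      by (simp add: gauss_sum_iso[OF \<theta>(1)]) (simp add: gauss_sum_def \<theta>(2))
    ultimately show "(\<exists>\<psi>\<in>iso G G'. ?B \<psi> \<and> ?D \<psi>) \<and> ?\<gamma>"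
      using \<theta>(1) by blast
  next
    assume "(\<exists>\<psi>\<in>iso G G'. ?B \<psi> \<and> ?D \<psi>) \<and> ?\<gamma>"
    then obtain \<psi> where \<psi>: "\<psi> \<in> iso G G'" "?B \<psi>" "?D \<psi>" and \<gamma>: ?\<gamma>
      by blast
    then have hom: "\<psi> \<in> hom G G'" by (simp add: iso_def)
    let ?p = "\<lambda>x. q' (\<psi> x)"
    have "card (carrier G) \<noteq> 0"
      using assms(2) G.one_closed by auto
    then have gauss: "(\<Sum>x\<in>carrier G. exp_qmodz (?p x)) = (\<Sum>x\<in>carrier G. exp_qmodz (q x))"
      using \<gamma> by (simp add: gauss_sum_iso[OF \<psi>(1)]) (simp add: gauss_sum_def)
    obtain \<theta> where \<theta>: "\<theta> \<in> iso G G" "\<And>x. x \<in> carrier G \<Longrightarrow> ?p (\<theta> x) = q x"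
    proof (rule Q.isometry_of_equal_invariants[of ?p])
      show "assoc_bilin G ?p x y = assoc_bilin G q x y"
        if "x \<in> carrier G" "y \<in> carrier G" for x y
        using \<psi>(2) that by (simp add: assoc_bilin_hom[OF hom])
      show "homogeneity_defect G ?p x = homogeneity_defect G q x" if "x \<in> carrier G" for x
        using \<psi>(3) that
        by (simp add: homogeneity_defect_hom[OF G.group_axioms G'.group_axioms hom])
    qed (use gauss in auto)
    have "\<psi> \<circ> \<theta> \<in> iso G G'"
      by (rule iso_set_trans[OF \<theta>(1) \<psi>(1)])
    moreover have "\<forall>x\<in>carrier G. q' ((\<psi> \<circ> \<theta>) x) = q x"
      using \<theta>(2) by simp
    ultimately show ?L
      unfolding quadratic_isomorphic_def by blast
  qed
qed

end
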